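(* Let $n\geq 1$ be an integer and let $Y$ be a domain in a complex manifold $X$. Let $z_1\in\partial Y$ and $z_2,\ldots,z_n\in\overline{Y}$, and assume that $z_1$ is an $A(Y,\{z_1,\ldots,z_n\})$ peak point. Then the point $\langle z_1,\ldots,z_n\rangle$ is an $A(Y^n_{sym},\{\langle z_1,\ldots,z_n\rangle\})$ peak point.
   Context: Symmetric power: for a complex manifold $X$, $X^n_{sym}$ is the quotient of $X^n$ (with the quotient topology) under the action of the group of all permutations of $\{1,\ldots,n\}$ permuting the coordinates; it carries the structure of a complex analytic space. The class of $(z_1,\ldots,z_n)$ is denoted $\langle z_1,\ldots,z_n\rangle$. For a domain $Y\subset X$, $Y^n_{sym}$ is regarded as the open subset $\{\langle w_1,\ldots,w_n\rangle: w_j\in Y\}$ of $X^n_{sym}$, and holomorphic functions on $Y^n_{sym}$ are identified with holomorphic functions on $Y^n$ that are invariant under permutations of the coordinates. Peak points: for a domain $Y$ in a complex manifold $X$ (similarly, for $Y^n_{sym}$ in $X^n_{sym}$) and a set $K\subset\overline{Y}$, put $A(Y,K):=\mathcal O(Y)\cap\mathcal C(Y\cup K)$, i.e. the continuous complex-valued functions on $Y\cup K$ that are holomorphic on $Y$. A point $z\in K$ is an $A(Y,K)$ peak point if there is an $f\in A(Y,K)$ such that $|f|<1$ on $Y$ and $f(z)=1$. *)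

theory Defs
  imports "HOL-Analysis.Analysis" "HOL-Combinatorics.Permutations"
begin

section \<open>Holomorphy in several complex variables\<close>

text \<open>
  A function of several complex variables is holomorphic on an open set if it is totally complex
  differentiable at each of its points: the Frechet derivative, which the library takes over the
  reals, exists and commutes with complex scalars. Only meant for open \<open>S\<close>.
\<close>

definition cvec_holomorphic_on :: "(complex ^ 'm \<Rightarrow> complex) \<Rightarrow> (complex ^ 'm) set \<Rightarrow> bool" where
  "cvec_holomorphic_on f S \<longleftrightarrow>
     (\<forall>x\<in>S. \<exists>D. (f has_derivative D) (at x) \<and> (\<forall>c v. D (c *s v) = c * D v))"

section \<open>Complex manifolds\<close>

text \<open>
  A chart is a pair of its domain and its coordinate map; the values of the coordinate map outside
  its domain are irrelevant.
\<close>

type_synonym ('a, 'm) chart = "'a set \<times> ('a \<Rightarrow> complex ^ 'm)"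

definition is_chart :: "'a topology \<Rightarrow> ('a, 'm::finite) chart \<Rightarrow> bool" where
  "is_chart X c \<longleftrightarrow>
     openin X (fst c) \<and> open (snd c ` fst c) \<and>
     homeomorphic_map (subtopology X (fst c)) (top_of_set (snd c ` fst c)) (snd c)"

definition chart_inv :: "('a, 'm) chart \<Rightarrow> complex ^ 'm \<Rightarrow> 'a" where
  "chart_inv c = inv_into (fst c) (snd c)"

definition complex_manifold :: "'a topology \<Rightarrow> ('a, 'm::finite) chart set \<Rightarrow> bool" where
  "complex_manifold X \<A> \<longleftrightarrow>
     Hausdorff_space X \<and> second_countable X \<and>
     (\<forall>c\<in>\<A>. is_chart X c) \<and> \<Union> (fst ` \<A>) = topspace X \<and>
     (\<forall>c\<in>\<A>. \<forall>d\<in>\<A>. \<forall>i.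
        cvec_holomorphic_on (\<lambda>y. snd d (chart_inv c y) $ i) (snd c ` (fst c \<inter> fst d)))"

definition holomorphic_functions ::
    "('a, 'm::finite) chart set \<Rightarrow> 'a set \<Rightarrow> ('a \<Rightarrow> complex) set" where
  "holomorphic_functions \<A> W =
     {f. \<forall>c\<in>\<A>. cvec_holomorphic_on (f \<circ> chart_inv c) (snd c ` (fst c \<inter> W))}"

definition domain_in :: "'a topology \<Rightarrow> 'a set \<Rightarrow> bool" where
  "domain_in X Y \<longleftrightarrow> openin X Y \<and> connectedin X Y \<and> Y \<noteq> {}"

section \<open>Cartesian and symmetric powers\<close>

text \<open>
  The coordinates are indexed by a finite type \<open>'n\<close>, so that \<open>n = CARD('n) \<ge> 1\<close>, and an
  \<open>n\<close>-tuple is a function on \<open>'n\<close>. The product charts take values in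
  \<open>complex ^ ('n \<times> 'm)\<close>, which stands for the \<open>n\<close>-th power of \<open>complex ^ 'm\<close>.
\<close>

definition power_topology :: "'a topology \<Rightarrow> ('n::finite \<Rightarrow> 'a) topology" where
  "power_topology X = product_topology (\<lambda>_. X) UNIV"

definition cart_power_set :: "'a set \<Rightarrow> ('n::finite \<Rightarrow> 'a) set" where
  "cart_power_set Y = {w. \<forall>j. w j \<in> Y}"

definition product_chart ::
    "('n::finite \<Rightarrow> ('a, 'm::finite) chart) \<Rightarrow> ('n \<Rightarrow> 'a, 'n \<times> 'm) chart" where
  "product_chart c =
     ({w. \<forall>j. w j \<in> fst (c j)}, \<lambda>w. \<chi> p. snd (c (fst p)) (w (fst p)) $ snd p)"

definition power_atlas ::
    "('a, 'm::finite) chart set \<Rightarrow> ('n::finite \<Rightarrow> 'a, 'n \<times> 'm) chart set" where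
  "power_atlas \<A> = {product_chart c | c. \<forall>j. c j \<in> \<A>}"

definition sym_class :: "('n::finite \<Rightarrow> 'a) \<Rightarrow> ('n \<Rightarrow> 'a) set" where
  "sym_class w = {w \<circ> p | p. p permutes UNIV}"

definition quotient_topology :: "'a topology \<Rightarrow> ('a \<Rightarrow> 'b) \<Rightarrow> 'b topology" where
  "quotient_topology T q =
     topology (\<lambda>U. U \<subseteq> q ` topspace T \<and> openin T {x \<in> topspace T. q x \<in> U})"

lemma openin_quotient_topology:
  "openin (quotient_topology T q) U \<longleftrightarrow>
     U \<subseteq> q ` topspace T \<and> openin T {x \<in> topspace T. q x \<in> U}"
proof -
  have "istopology (\<lambda>U. U \<subseteq> q ` topspace T \<and> openin T {x \<in> topspace T. q x \<in> U})"
    unfolding istopology_def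
  proof (intro conjI allI impI)
    fix S U
    assume S: "S \<subseteq> q ` topspace T \<and> openin T {x \<in> topspace T. q x \<in> S}"
      and U: "U \<subseteq> q ` topspace T \<and> openin T {x \<in> topspace T. q x \<in> U}"
    have "{x \<in> topspace T. q x \<in> S \<inter> U} =
        {x \<in> topspace T. q x \<in> S} \<inter> {x \<in> topspace T. q x \<in> U}"
      by blast
    with S U show "openin T {x \<in> topspace T. q x \<in> S \<inter> U}" by auto
    show "S \<inter> U \<subseteq> q ` topspace T" using S by blast
  next
    fix \<K>
    assume K: "\<forall>S\<in>\<K>. S \<subseteq> q ` topspace T \<and> openin T {x \<in> topspace T. q x \<in> S}"
    have "{x \<in> topspace T. q x \<in> \<Union>\<K>} = (\<Union>S\<in>\<K>. {x \<in> topspace T. q x \<in> S})"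
      by blast
    with K show "openin T {x \<in> topspace T. q x \<in> \<Union>\<K>}" by auto
    show "\<Union>\<K> \<subseteq> q ` topspace T" using K by blast
  qed
  then show ?thesis
    unfolding quotient_topology_def by simp
qed

lemma topspace_quotient_topology: "topspace (quotient_topology T q) = q ` topspace T"
proof -
  have "{x \<in> topspace T. q x \<in> q ` topspace T} = topspace T" by blast
  then have "openin (quotient_topology T q) (q ` topspace T)"
    by (simp add: openin_quotient_topology)
  then show ?thesis
    by (metis openin_quotient_topology openin_subset openin_topspace subset_antisym)
qed

lemma quotient_map_quotient_topology: "quotient_map T (quotient_topology T q) q"
  by (simp add: quotient_map_def openin_quotient_topology topspace_quotient_topology)

definition sym_power_topology :: "'a topology \<Rightarrow> ('n::finite \<Rightarrow> 'a) set topology" where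
  "sym_power_topology X = quotient_topology (power_topology X) sym_class"

definition sym_power_set :: "'a set \<Rightarrow> ('n::finite \<Rightarrow> 'a) set set" where
  "sym_power_set Y = sym_class ` cart_power_set Y"

text \<open>
  Holomorphic functions on a symmetric power are the functions whose pullback to the Cartesian
  power, which is automatically invariant under permutations, is holomorphic.
\<close>

definition sym_holomorphic_functions ::
    "('a, 'm::finite) chart set \<Rightarrow> 'a set \<Rightarrow> (('n::finite \<Rightarrow> 'a) set \<Rightarrow> complex) set" where
  "sym_holomorphic_functions \<A> Y =
     {F. F \<circ> sym_class \<in> holomorphic_functions (power_atlas \<A>) (cart_power_set Y)}"

section \<open>Peak points\<close>

text \<open>
  \<open>\<O>\<close> is the set of functions that are holomorphic on \<open>Y\<close>; it is a parameter so that the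
  definitions apply both to manifolds and to symmetric powers.
\<close>

definition A_algebra ::
    "'b topology \<Rightarrow> ('b \<Rightarrow> complex) set \<Rightarrow> 'b set \<Rightarrow> 'b set \<Rightarrow> ('b \<Rightarrow> complex) set" where
  "A_algebra T \<O> Y K = {f \<in> \<O>. continuous_map (subtopology T (Y \<union> K)) euclidean f}"

definition A_peak_point ::
    "'b topology \<Rightarrow> ('b \<Rightarrow> complex) set \<Rightarrow> 'b set \<Rightarrow> 'b set \<Rightarrow> 'b \<Rightarrow> bool" where
  "A_peak_point T \<O> Y K z \<longleftrightarrow>
     K \<subseteq> T closure_of Y \<and> z \<in> K \<and>
     (\<exists>f\<in>A_algebra T \<O> Y K. (\<forall>y\<in>Y. cmod (f y) < 1) \<and> f z = 1)"

end

theory Submission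
  imports Defs
begin

text \<open>
  If \<open>f\<close> peaks at \<open>z k\<close>, then \<open>1 - f\<close> maps \<open>Y\<close> into the open right half plane, so its principal
  \<open>n\<close>-th root has argument in \<open>(-\<pi>/2n, \<pi>/2n)\<close>. Hence the product of the \<open>(1 - f (w j)) powr (1/n)\<close>
  is symmetric, has positive real part on \<open>Y\<^sup>n\<close> and vanishes at \<open>z\<close>, and
  composing it with \<open>\<zeta> \<mapsto> 1 / (1 + \<zeta>)\<close> gives a peak function. It is continuous up to
  \<open>z\<close> because the root is continuous on the closed half plane, including \<open>0\<close>.
\<close>

section \<open>Symmetric powers\<close>

lemma topspace_power_topology: "topspace (power_topology X) = cart_power_set (topspace X)"
  by (auto simp: power_topology_def cart_power_set_def topspace_product_topology PiE_UNIV_domain)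

lemma continuous_map_permute:
  "continuous_map (power_topology X) (power_topology X) (\<lambda>w. w \<circ> p)"
  unfolding power_topology_def continuous_map_componentwise_UNIV
  by (auto intro: continuous_map_product_projection)

lemma mem_sym_class: "w \<in> sym_class w"
  by (auto simp: sym_class_def intro!: exI[of _ id] permutes_id)

lemma sym_class_permute:
  assumes "p permutes UNIV"
  shows "sym_class (w \<circ> p) = sym_class w"
proof
  show "sym_class (w \<circ> p) \<subseteq> sym_class w"
    unfolding sym_class_def using assms by (auto simp: comp_assoc intro: permutes_compose)
  show "sym_class w \<subseteq> sym_class (w \<circ> p)"
  proof
    fix v assume "v \<in> sym_class w"
    then obtain s where s: "s permutes UNIV" "v = w \<circ> s"
      by (auto simp: sym_class_def)
    have "v = (w \<circ> p) \<circ> (inv p \<circ> s)"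
      using permutes_inverses(1)[OF assms] by (simp add: s fun_eq_iff)
    moreover have "inv p \<circ> s permutes UNIV"
      using assms s by (simp add: permutes_compose permutes_inv)
    ultimately show "v \<in> sym_class (w \<circ> p)"
      by (auto simp: sym_class_def)
  qed
qed

lemma sym_class_eq_iff: "sym_class v = sym_class w \<longleftrightarrow> (\<exists>p. p permutes UNIV \<and> v = w \<circ> p)"
  using mem_sym_class[of v] by (auto simp: sym_class_permute) (auto simp: sym_class_def)

text \<open>The saturation of an open set is the union of its preimages under the coordinate
  permutations, each of which acts continuously. Openness, stronger than being a quotient map, is
  what survives restriction to subsets that are not open.\<close>

lemma open_map_sym_class:
  "open_map (power_topology X :: ('n::finite \<Rightarrow> 'a) topology) (sym_power_topology X) sym_class"
  unfolding open_map_def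
proof (intro allI impI)
  fix U :: "('n \<Rightarrow> 'a) set"
  let ?T = "power_topology X :: ('n \<Rightarrow> 'a) topology"
  assume U: "openin ?T U"
  then have sub: "U \<subseteq> topspace ?T" by (rule openin_subset)
  \<comment> \<open>A class meets \<open>U\<close> exactly when some reordering of its
    representative lies in \<open>U\<close>.\<close>
  have "sym_class x \<in> sym_class ` U \<longleftrightarrow> (\<exists>p. p permutes UNIV \<and> x \<circ> p \<in> U)" for x
    by (metis imageE imageI sym_class_eq_iff)
  then have "{x \<in> topspace ?T. sym_class x \<in> sym_class ` U} =
      (\<Union>p\<in>{p. p permutes UNIV}. {x \<in> topspace ?T. x \<circ> p \<in> U})"
    by blast
  moreover have "openin ?T {x \<in> topspace ?T. x \<circ> p \<in> U}" for p
    using continuous_map_permute U by (rule openin_continuous_map_preimage)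
  ultimately have "openin ?T {x \<in> topspace ?T. sym_class x \<in> sym_class ` U}"
    by (simp only:) (intro openin_Union, auto)
  then show "openin (sym_power_topology X) (sym_class ` U)"
    using sub unfolding sym_power_topology_def openin_quotient_topology by blast
qed

lemma quotient_map_sym_class: "quotient_map (power_topology X) (sym_power_topology X) sym_class"
  unfolding sym_power_topology_def by (rule quotient_map_quotient_topology)

text \<open>A quotient map need not stay one over an arbitrary subset, but an open continuous
  surjection does when restricted to a full preimage. The intended \<open>S\<close> is the symmetric
  power of \<open>Y\<close> with one boundary class added, in general not an open set.\<close>

lemma continuous_map_sym_power_subset:
  assumes "S \<subseteq> topspace (sym_power_topology X)"
    and "continuous_map (subtopology (power_topology X) {w. sym_class w \<in> S}) Z (F \<circ> sym_class)"
  shows "continuous_map (subtopology (sym_power_topology X) S) Z F"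
proof -
  let ?T = "power_topology X" and ?R = "{w \<in> topspace (power_topology X). sym_class w \<in> S}"
  have cont: "continuous_map ?T (sym_power_topology X) sym_class"
    by (simp add: quotient_imp_continuous_map quotient_map_sym_class)
  have "quotient_map (subtopology ?T ?R) (subtopology (sym_power_topology X) S) sym_class"
  proof (rule continuous_open_imp_quotient_map)
    show "continuous_map (subtopology ?T ?R) (subtopology (sym_power_topology X) S) sym_class"
      by (intro continuous_map_into_subtopology continuous_map_from_subtopology cont) auto
    show "open_map (subtopology ?T ?R) (subtopology (sym_power_topology X) S) sym_class"
      by (rule open_map_restriction[OF open_map_sym_class refl])
    show "sym_class ` topspace (subtopology ?T ?R) =
        topspace (subtopology (sym_power_topology X) S)"
      using assms(1) by (auto simp: sym_power_topology_def topspace_quotient_topology)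
  qed
  moreover have "?R = topspace ?T \<inter> {w. sym_class w \<in> S}"
    by auto
  then have "subtopology ?T ?R = subtopology ?T {w. sym_class w \<in> S}"
    by (simp only: subtopology_restrict)
  ultimately show ?thesis
    using assms(2) by (metis continuous_compose_quotient_map)
qed

text \<open>The closure of a product is the product of the closures, and the continuous map
  \<open>sym_class\<close> sends closures into closures.\<close>

lemma sym_class_in_closure:
  fixes z :: "'n::finite \<Rightarrow> 'a"
  assumes "\<And>j. z j \<in> X closure_of Y"
  shows "sym_class z \<in> sym_power_topology X closure_of sym_power_set Y"
proof -
  have "(cart_power_set Y :: ('n \<Rightarrow> 'a) set) = PiE UNIV (\<lambda>_. Y)"
    by (auto simp: cart_power_set_def PiE_UNIV_domain)
  moreover have "z \<in> PiE UNIV (\<lambda>_. X closure_of Y)"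
    using assms by (simp add: PiE_UNIV_domain)
  ultimately have "z \<in> power_topology X closure_of cart_power_set Y"
    by (simp only: power_topology_def closure_of_product_topology)
  then show ?thesis
    unfolding sym_power_set_def
    using continuous_map_image_closure_subset[OF quotient_imp_continuous_map[OF quotient_map_sym_class]]
    by blast
qed

section \<open>Holomorphy in product charts\<close>

text \<open>The pointwise form of \<open>cvec_holomorphic_on\<close>, so that chain and product
  rules apply at a single point without tracking open sets.\<close>

definition cvec_differentiable :: "(complex ^ 'm \<Rightarrow> complex) \<Rightarrow> complex ^ 'm \<Rightarrow> bool" where
  "cvec_differentiable f x \<longleftrightarrow> (\<exists>D. (f has_derivative D) (at x) \<and> (\<forall>c v. D (c *s v) = c * D v))"

lemma cvec_holomorphic_on_iff: "cvec_holomorphic_on f S \<longleftrightarrow> (\<forall>x\<in>S. cvec_differentiable f x)"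
  by (simp add: cvec_holomorphic_on_def cvec_differentiable_def)

lemma cvec_differentiable_compose:
  assumes "cvec_differentiable f x" "h field_differentiable (at (f x))"
  shows "cvec_differentiable (\<lambda>y. h (f y)) x"
proof -
  obtain D where D: "(f has_derivative D) (at x)" "\<forall>c v. D (c *s v) = c * D v"
    using assms(1) by (auto simp: cvec_differentiable_def)
  obtain h' where h: "(h has_field_derivative h') (at (f x))"
    using assms(2) by (auto simp: field_differentiable_def)
  have "((\<lambda>y. h (f y)) has_derivative (\<lambda>v. h' * D v)) (at x)"
    using has_derivative_compose[OF D(1) h[unfolded has_field_derivative_def]] .
  then show ?thesis
    unfolding cvec_differentiable_def using D(2)
    by (intro exI[of _ "\<lambda>v. h' * D v"]) auto
qed

lemma cvec_differentiable_prod: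
  fixes f :: "'i \<Rightarrow> complex ^ 'm \<Rightarrow> complex"
  assumes "\<And>i. i \<in> I \<Longrightarrow> cvec_differentiable (f i) x"
  shows "cvec_differentiable (\<lambda>y. \<Prod>i\<in>I. f i y) x"
proof -
  obtain D where D: "\<And>i. i \<in> I \<Longrightarrow> (f i has_derivative D i) (at x)"
      "\<And>i c v. i \<in> I \<Longrightarrow> D i (c *s v) = c * D i v"
    using assms unfolding cvec_differentiable_def by metis
  show ?thesis
    unfolding cvec_differentiable_def
    \<comment> \<open>The witness stays schematic until \<open>has_derivative_prod\<close>
      instantiates it with the Leibniz sum, which inherits complex homogeneity from its
      terms.\<close>
    by (rule exI, rule conjI, rule has_derivative_prod, erule D(1))
      (auto simp: D(2) sum_distrib_left mult.assoc)
qed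

text \<open>Projection to the \<open>j\<close>-th block is complex linear, so composing with it
  keeps the derivative compatible with complex scalars.\<close>

lemma cvec_differentiable_block:
  fixes g :: "complex ^ 'm::finite \<Rightarrow> complex" and x :: "complex ^ ('n::finite \<times> 'm)"
  assumes "cvec_differentiable g (\<chi> i. x $ (j, i))"
  shows "cvec_differentiable (\<lambda>y. g (\<chi> i. y $ (j, i))) x"
proof -
  let ?\<pi> = "\<lambda>y :: complex ^ ('n \<times> 'm). (\<chi> i. y $ (j, i)) :: complex ^ 'm"
  obtain D where D: "(g has_derivative D) (at (?\<pi> x))" "\<forall>c v. D (c *s v) = c * D v"
    using assms by (auto simp: cvec_differentiable_def)
  have "linear ?\<pi>"
    by (rule linearI) (auto simp: vec_eq_iff)
  then have "(?\<pi> has_derivative ?\<pi>) (at x)"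
    by (simp add: linear_imp_has_derivative)
  then have "((\<lambda>y. g (?\<pi> y)) has_derivative (\<lambda>v. D (?\<pi> v))) (at x)"
    using D(1) by (rule has_derivative_compose)
  moreover have "?\<pi> (c *s v) = c *s ?\<pi> v" for c v
    by (simp add: vec_eq_iff)
  ultimately show ?thesis
    unfolding cvec_differentiable_def using D(2)
    by (intro exI[of _ "\<lambda>v. D (?\<pi> v)"]) auto
qed

lemma cvec_differentiable_transform:
  assumes "cvec_differentiable f x" "open S" "x \<in> S" "\<And>y. y \<in> S \<Longrightarrow> f y = g y"
  shows "cvec_differentiable g x"
  using assms unfolding cvec_differentiable_def
  by (meson has_derivative_transform_within_open)

section \<open>Injectivity, inverse and image of product charts\<close>

lemma is_chart_inj_on: "is_chart X c \<Longrightarrow> inj_on (snd c) (fst c)"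
  by (auto simp: is_chart_def dest!: homeomorphic_imp_injective_map openin_subset
      elim!: inj_on_subset)

lemma inj_on_product_chart:
  assumes "\<And>j. inj_on (snd (c j)) (fst (c j))"
  shows "inj_on (snd (product_chart c)) (fst (product_chart c))"
proof (rule inj_onI)
  fix v w
  assume vw: "v \<in> fst (product_chart c)" "w \<in> fst (product_chart c)"
    and eq: "snd (product_chart c) v = snd (product_chart c) w"
  show "v = w"
  proof
    fix j
    have "snd (c j) (v j) $ i = snd (c j) (w j) $ i" for i
      using arg_cong[OF eq, of "\<lambda>y. y $ (j, i)"] by (simp add: product_chart_def)
    then show "v j = w j"
      using vw assms[of j] by (auto simp: product_chart_def vec_eq_iff inj_on_def)
  qed
qed

lemma block_product_chart: "(\<chi> i. snd (product_chart c) w $ (j, i)) = snd (c j) (w j)"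
  by (simp add: product_chart_def vec_eq_iff)

text \<open>The inverse acts block by block. The restriction on \<open>y\<close> is essential to the
  argument: outside the image, \<open>inv_into\<close> returns unspecified values.\<close>

lemma chart_inv_product_chart:
  assumes "\<And>j. inj_on (snd (c j)) (fst (c j))" "y \<in> snd (product_chart c) ` fst (product_chart c)"
  shows "chart_inv (product_chart c) y = (\<lambda>j. chart_inv (c j) (\<chi> i. y $ (j, i)))"
proof -
  obtain w where w: "w \<in> fst (product_chart c)" "y = snd (product_chart c) w"
    using assms(2) by auto
  have "chart_inv (c j) (\<chi> i. y $ (j, i)) = w j" for j
    using w(1) assms(1)[of j]
    by (simp add: w(2) block_product_chart chart_inv_def product_chart_def)
  moreover have "chart_inv (product_chart c) y = w"
    unfolding chart_inv_def w(2) using inj_on_product_chart assms(1) w(1) by (blast intro: inv_into_f_f)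
  ultimately show ?thesis by auto
qed

lemma image_product_chart:
  "snd (product_chart c) ` fst (product_chart c) =
     {y. \<forall>j. (\<chi> i. y $ (j, i)) \<in> snd (c j) ` fst (c j)}" (is "?L = ?R")
proof
  show "?L \<subseteq> ?R"
    by (auto simp: block_product_chart) (auto simp: product_chart_def)
  show "?R \<subseteq> ?L"
  proof
    fix y assume "y \<in> ?R"
    then have "\<forall>j. \<exists>a. a \<in> fst (c j) \<and> (\<chi> i. y $ (j, i)) = snd (c j) a"
      by auto
    then obtain w where w: "\<And>j. w j \<in> fst (c j)" "\<And>j. (\<chi> i. y $ (j, i)) = snd (c j) (w j)"
      by metis
    have "y $ (j, i) = snd (c j) (w j) $ i" for j i
      using w(2)[of j] by (auto simp: vec_eq_iff)
    then have "y = snd (product_chart c) w"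
      by (auto simp: product_chart_def vec_eq_iff)
    then show "y \<in> ?L"
      using w(1) by (auto simp: product_chart_def)
  qed
qed

lemma open_image_product_chart:
  fixes c :: "'n::finite \<Rightarrow> ('a, 'm::finite) chart"
  assumes "\<And>j. open (snd (c j) ` fst (c j))"
  shows "open (snd (product_chart c) ` fst (product_chart c))"
proof -
  have "open ((\<lambda>y :: complex ^ ('n \<times> 'm). (\<chi> i. y $ (j, i)) :: complex ^ 'm) -`
      (snd (c j) ` fst (c j)))" for j
    using assms by (intro open_vimage continuous_intros)
  then have "open (\<Inter>j. (\<lambda>y :: complex ^ ('n \<times> 'm). (\<chi> i. y $ (j, i)) :: complex ^ 'm) -`
      (snd (c j) ` fst (c j)))"
    by (intro open_INT) auto
  also have "\<dots> = {y. \<forall>j. (\<chi> i. y $ (j, i)) \<in> snd (c j) ` fst (c j)}"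
    by auto
  finally show ?thesis
    by (simp add: image_product_chart)
qed

text \<open>In a product chart each factor depends on one block of coordinates only, so the product
  and chain rules reduce the claim to the holomorphy of \<open>f\<close> in single charts.\<close>

lemma holomorphic_functions_power:
  fixes f :: "'a \<Rightarrow> complex" and \<A> :: "('a, 'm::finite) chart set"
  assumes charts: "\<And>c. c \<in> \<A> \<Longrightarrow> is_chart X c"
    and f: "f \<in> holomorphic_functions \<A> Y"
    and r: "\<And>a. a \<in> Y \<Longrightarrow> r field_differentiable (at (f a))"
    and h: "\<And>w :: 'n::finite \<Rightarrow> 'a. w \<in> cart_power_set Y \<Longrightarrow>
      h field_differentiable (at (\<Prod>j\<in>UNIV. r (f (w j))))"
  shows "(\<lambda>w :: 'n \<Rightarrow> 'a. h (\<Prod>j\<in>UNIV. r (f (w j)))) \<in>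
    holomorphic_functions (power_atlas \<A>) (cart_power_set Y)"
  unfolding holomorphic_functions_def mem_Collect_eq cvec_holomorphic_on_iff
proof (intro ballI)
  fix C :: "('n \<Rightarrow> 'a, 'n \<times> 'm) chart" and y
  assume "C \<in> power_atlas \<A>" and y: "y \<in> snd C ` (fst C \<inter> cart_power_set Y)"
  then obtain c where C: "C = product_chart c" and c: "\<And>j. c j \<in> \<A>"
    by (auto simp: power_atlas_def)
  obtain w where w: "w \<in> fst (product_chart c)" "w \<in> cart_power_set Y"
      "y = snd (product_chart c) w"
    using y C by auto
  have inj: "inj_on (snd (c j)) (fst (c j))" for j
    using charts[OF c] by (rule is_chart_inj_on)
  let ?V = "snd (product_chart c) ` fst (product_chart c)"
  have "open ?V"
    using charts[OF c] by (intro open_image_product_chart) (simp add: is_chart_def)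
  have yV: "y \<in> ?V" using w by blast
  have wj: "w j \<in> fst (c j)" "w j \<in> Y" for j
    using w by (auto simp: product_chart_def cart_power_set_def)
  have inv: "chart_inv (c j) (\<chi> i. y $ (j, i)) = w j" for j
    using wj(1) inj by (simp add: w(3) block_product_chart chart_inv_def)
  have "cvec_differentiable (f \<circ> chart_inv (c j)) (\<chi> i. y $ (j, i))" for j
    using f c[of j] wj[of j] w(3)
    by (auto simp: holomorphic_functions_def cvec_holomorphic_on_iff block_product_chart)
  then have "cvec_differentiable (\<lambda>y. f (chart_inv (c j) (\<chi> i. y $ (j, i)))) y" for j
    by (auto dest: cvec_differentiable_block simp: o_def)
  then have "cvec_differentiable (\<lambda>y. r (f (chart_inv (c j) (\<chi> i. y $ (j, i))))) y" for j
    by (rule cvec_differentiable_compose) (simp add: inv r wj(2))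
  then have "cvec_differentiable
      (\<lambda>y. h (\<Prod>j\<in>UNIV. r (f (chart_inv (c j) (\<chi> i. y $ (j, i)))))) y"
    using h[OF w(2)]
    by (intro cvec_differentiable_compose[of _ _ h] cvec_differentiable_prod) (simp_all add: inv)
  \<comment> \<open>The blockwise formula agrees with \<open>chart_inv C\<close> only on
    \<open>?V\<close>; since \<open>?V\<close> is an open neighbourhood of \<open>y\<close>,
    differentiability carries over.\<close>
  then show "cvec_differentiable ((\<lambda>w. h (\<Prod>j\<in>UNIV. r (f (w j)))) \<circ> chart_inv C) y"
    by (rule cvec_differentiable_transform[OF _ \<open>open ?V\<close> yV])
      (simp add: C chart_inv_product_chart inj)
qed

section \<open>Products of roots in the right half plane\<close>

text \<open>Each principal argument lies strictly between \<open>-pi/2\<close> and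
  \<open>pi/2\<close>. Dividing by \<open>n\<close> and adding \<open>n\<close> of them stays in
  that interval, where the cosine is positive.\<close>

lemma Re_prod_powr_inverse_card_pos:
  fixes a :: "'n::finite \<Rightarrow> complex"
  assumes "\<And>j. Re (a j) > 0"
  shows "Re (\<Prod>j\<in>UNIV. a j powr (1 / of_nat CARD('n))) > 0"
proof -
  let ?n = "CARD('n)"
  define s where "s = (\<Sum>j\<in>UNIV. Ln (a j) / of_nat ?n)"
  have nz: "a j \<noteq> 0" for j
    using assms[of j] by auto
  \<comment> \<open>Nonzero bases make every \<open>powr\<close> an exponential of
    \<open>Ln\<close>, so \<open>Im s\<close> is an argument of the product.\<close>
  then have "(\<Prod>j\<in>UNIV. a j powr (1 / of_nat ?n)) = exp s"
    by (simp add: powr_def exp_sum s_def)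
  moreover have "\<bar>Im s\<bar> < pi / 2"
  proof -
    have "\<bar>Im (Ln (a j))\<bar> / ?n < pi / 2 / ?n" for j
      using Re_Ln_pos_lt_imp[OF assms] by (intro divide_strict_right_mono) auto
    then have "\<bar>Im (Ln (a j) / of_nat ?n)\<bar> < pi / 2 / ?n" for j
      by simp
    then have "(\<Sum>j\<in>(UNIV :: 'n set). \<bar>Im (Ln (a j) / of_nat ?n)\<bar>) < (\<Sum>j\<in>(UNIV :: 'n set). pi / 2 / ?n)"
      by (intro sum_strict_mono) auto
    then show ?thesis
      unfolding s_def Im_sum using sum_abs[of "\<lambda>j. Im (Ln (a j) / of_nat ?n)" UNIV]
      by simp
  qed
  then have "cos (Im s) > 0"
    by (intro cos_gt_zero_pi) auto
  ultimately show ?thesis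
    by (simp add: Re_exp)
qed

text \<open>A vanishing factor makes the whole product zero, because \<open>0 powr s\<close> is
  \<open>0\<close>; otherwise the strict version applies.\<close>

lemma Re_prod_powr_inverse_card_nonneg:
  fixes a :: "'n::finite \<Rightarrow> complex"
  assumes "\<And>j. Re (a j) > 0 \<or> a j = 0"
  shows "Re (\<Prod>j\<in>UNIV. a j powr (1 / of_nat CARD('n))) \<ge> 0"
proof (cases "\<exists>j. a j = 0")
  case True
  then have "(\<Prod>j\<in>UNIV. a j powr (1 / of_nat CARD('n))) = 0"
    by (auto simp: prod_zero_iff)
  then show ?thesis by (metis order_refl zero_complex.sel(1))
next
  case False
  then show ?thesis
    using Re_prod_powr_inverse_card_pos assms by (metis less_imp_le)
qed

lemma norm_le_1_on_closure:
  fixes f :: "'a \<Rightarrow> 'b::real_normed_vector"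
  assumes "continuous_map (subtopology X (Y \<union> K)) euclidean f" "\<And>y. y \<in> Y \<Longrightarrow> norm (f y) < 1"
    and "K \<subseteq> X closure_of Y" "a \<in> Y \<union> K"
  shows "norm (f a) \<le> 1"
proof (cases "a \<in> Y")
  case False
  \<comment> \<open>The closure is taken inside \<open>Y \<union> K\<close>, because
    \<open>f\<close> is known to be continuous only there.\<close>
  then have "a \<in> subtopology X (Y \<union> K) closure_of Y"
    using assms(3,4) by (auto simp: closure_of_subtopology Int_absorb1)
  then have "f a \<in> closure (f ` Y)"
    using continuous_map_image_closure_subset[OF assms(1), of Y] by auto
  moreover have "closure (f ` Y) \<subseteq> cball 0 1"
    by (intro closure_minimal) (auto intro: less_imp_le[OF assms(2)])
  ultimately show ?thesis by auto
qed (use assms(2) less_imp_le in blast)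

section \<open>The peak function\<close>

text \<open>The closed unit disc meets the half plane \<open>Re u \<ge> 1\<close> only at
  \<open>u = 1\<close>.\<close>

lemma Re_one_minus_cases:
  assumes "cmod u \<le> 1"
  shows "Re (1 - u) > 0 \<or> 1 - u = 0"
proof (rule ccontr)
  assume "\<not> ?thesis"
  then have "Re u \<ge> 1" "u \<noteq> 1" by auto
  moreover have "(Re u)\<^sup>2 + (Im u)\<^sup>2 \<le> 1"
    using assms by (metis cmod_power2 norm_ge_zero one_power2 power_mono)
  moreover have "(Re u)\<^sup>2 \<ge> 1"
    using \<open>Re u \<ge> 1\<close> by simp
  ultimately have "(Im u)\<^sup>2 \<le> 0"
    by linarith
  moreover have "Re u = 1"
    using \<open>Re u \<ge> 1\<close> assms complex_Re_le_cmod[of u] by linarith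
  ultimately show False
    using \<open>u \<noteq> 1\<close> by (simp add: complex_eq_iff)
qed

theorem theorem6:
  fixes X :: "'a topology"
    and \<A> :: "('a, 'm::finite) chart set"
    and Y :: "'a set"
    and z :: "'n::finite \<Rightarrow> 'a"
    and k :: 'n
  assumes "complex_manifold X \<A>"
    and "domain_in X Y"
    and "z k \<in> X frontier_of Y"
    and "\<And>j. j \<noteq> k \<Longrightarrow> z j \<in> X closure_of Y"
    and "A_peak_point X (holomorphic_functions \<A> Y) Y (range z) (z k)"
  shows "A_peak_point (sym_power_topology X) (sym_holomorphic_functions \<A> Y)
           (sym_power_set Y) {sym_class z} (sym_class z)"
proof -
  obtain f where f_hol: "f \<in> holomorphic_functions \<A> Y"
    and f_cont: "continuous_map (subtopology X (Y \<union> range z)) euclidean f"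
    and f_less: "\<And>y. y \<in> Y \<Longrightarrow> cmod (f y) < 1" and f_z: "f (z k) = 1"
    and z_closure: "range z \<subseteq> X closure_of Y"
    using assms(5) by (auto simp: A_peak_point_def A_algebra_def)
  define r :: "complex \<Rightarrow> complex" where "r u = (1 - u) powr (1 / of_nat CARD('n))" for u
  define P where "P w = (\<Prod>j\<in>UNIV. r (f (w j)))" for w :: "'n \<Rightarrow> 'a"
  define G where "G w = 1 / (1 + P w)" for w
  \<comment> \<open>\<open>F\<close> evaluates \<open>G\<close> at an arbitrary representative of
    the class; the permutation invariance of \<open>P\<close> makes the choice immaterial.\<close>
  define F where "F C = G (SOME w. w \<in> C)" for C

  have P_perm: "P (w \<circ> p) = P w" if "p permutes UNIV" for w p
    unfolding P_def using that prod.permute[OF that, of "\<lambda>j. r (f (w j))"] by (simp add: o_def)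
  have F_class: "F (sym_class w) = G w" for w
  proof -
    have "(SOME v. v \<in> sym_class w) \<in> sym_class w"
      by (metis mem_sym_class someI)
    then show ?thesis
      by (auto simp: F_def sym_class_def G_def P_perm)
  qed
  have FG: "F \<circ> sym_class = G"
    by (auto simp: F_class)

  have f_le: "cmod (f a) \<le> 1" if "a \<in> Y \<union> range z" for a
    using f_cont f_less z_closure that by (rule norm_le_1_on_closure)
  have Re_pos: "Re (1 - f a) > 0" if "a \<in> Y" for a
    using f_less[OF that] complex_Re_le_cmod[of "f a"] by simp
  have P_pos: "Re (P w) > 0" if "w \<in> cart_power_set Y" for w
    unfolding P_def r_def using that Re_pos
    by (intro Re_prod_powr_inverse_card_pos) (auto simp: cart_power_set_def)
  \<comment> \<open>This covers the boundary values as well, and keeps \<open>1 + P w\<close> away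
    from zero when continuity at \<open>z\<close> is proved.\<close>
  have P_nonneg: "Re (P w) \<ge> 0" if "w \<in> cart_power_set (Y \<union> range z)" for w
    unfolding P_def r_def using that f_le Re_one_minus_cases
    by (intro Re_prod_powr_inverse_card_nonneg) (auto simp: cart_power_set_def)

  have F_hol: "F \<in> sym_holomorphic_functions \<A> Y"
  proof -
    have "(\<lambda>w :: 'n \<Rightarrow> 'a. 1 / (1 + (\<Prod>j\<in>UNIV. r (f (w j))))) \<in>
        holomorphic_functions (power_atlas \<A>) (cart_power_set Y)"
    proof (rule holomorphic_functions_power[of \<A> X f Y r "\<lambda>\<zeta>. 1 / (1 + \<zeta>)"])
      show "is_chart X c" if "c \<in> \<A>" for c
        using assms(1) that by (simp add: complex_manifold_def)
      show "f \<in> holomorphic_functions \<A> Y"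
        by (rule f_hol)
      show "r field_differentiable at (f a)" if "a \<in> Y" for a
      proof -
        \<comment> \<open>The base stays off the branch cut of the principal power.\<close>
        have "1 - f a \<notin> \<real>\<^sub>\<le>\<^sub>0"
          using Re_pos[OF that] by (auto simp: complex_nonpos_Reals_iff)
        then show ?thesis
          unfolding r_def field_differentiable_def
          by (auto intro!: exI derivative_eq_intros)
      qed
      show "(\<lambda>\<zeta>. 1 / (1 + \<zeta>)) field_differentiable at (\<Prod>j\<in>UNIV. r (f (w j)))"
        if "w \<in> cart_power_set Y" for w :: "'n \<Rightarrow> 'a"
      proof -
        have "1 + P w \<noteq> 0"
          using P_pos[OF that] by (auto simp: complex_eq_iff)
        then show ?thesis
          by (auto intro!: derivative_intros simp: P_def)
      qed
    qed
    then show ?thesis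
      by (simp add: sym_holomorphic_functions_def FG G_def[abs_def] P_def)
  qed

  have F_cont: "continuous_map
      (subtopology (sym_power_topology X) (sym_power_set Y \<union> {sym_class z})) euclidean F"
  proof (rule continuous_map_sym_power_subset)
    have "Y \<union> range z \<subseteq> topspace X"
      using assms(2) z_closure
      by (auto simp: domain_in_def dest: openin_subset in_closure_of[THEN iffD1])
    then show "sym_power_set Y \<union> {sym_class z} \<subseteq> topspace (sym_power_topology X)"
      by (auto simp: sym_power_topology_def topspace_quotient_topology topspace_power_topology
          sym_power_set_def cart_power_set_def intro!: imageI)
    let ?K = "cart_power_set (Y \<union> range z) :: ('n \<Rightarrow> 'a) set"
    let ?S = "{w. sym_class w \<in> sym_power_set Y \<union> {sym_class z}}"
    \<comment> \<open>Every representative of the class of \<open>z\<close> is some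
      \<open>z \<circ> p\<close>, with coordinates in \<open>range z\<close>. It therefore suffices
      to prove continuity of \<open>G\<close> on the larger set \<open>?K\<close>, which is a
      product.\<close>
    have sub: "?S \<subseteq> ?K"
      by (auto simp: sym_power_set_def sym_class_eq_iff cart_power_set_def)
    have K: "subtopology (power_topology X) ?K =
        product_topology (\<lambda>_. subtopology X (Y \<union> range z)) UNIV"
      unfolding power_topology_def subtopology_product_topology[symmetric]
      by (auto simp: cart_power_set_def PiE_UNIV_domain intro!: arg_cong2[where f = subtopology])
    \<comment> \<open>On the closed disc \<open>1 - u\<close> has nonnegative real part. At
      \<open>u = 1\<close> the base is zero, and continuity holds because the exponent has positive
      real part.\<close>
    have "continuous_on {u. cmod u \<le> 1} r"
      unfolding r_def
      by (intro continuous_on_powr_complex continuous_intros)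
        (auto intro: order_trans[OF complex_Re_le_cmod])
    then have "continuous_map (top_of_set {u. cmod u \<le> 1}) euclidean r"
      by simp
    moreover have "continuous_map (subtopology X (Y \<union> range z)) (top_of_set {u. cmod u \<le> 1}) f"
      using f_cont f_le by (auto intro!: continuous_map_into_subtopology)
    ultimately have "continuous_map (subtopology X (Y \<union> range z)) euclidean (r \<circ> f)"
      by (rule continuous_map_compose[rotated])
    then have "continuous_map (subtopology (power_topology X) ?K) euclidean (\<lambda>w. r (f (w j)))" for j
      unfolding K
      using continuous_map_compose[OF continuous_map_product_projection[of j UNIV]]
      by (fastforce simp: o_def)
    moreover have "1 + P w \<noteq> 0" if "w \<in> ?K" for w
      using P_nonneg[OF that] by (auto simp: complex_eq_iff)
    ultimately have "continuous_map (subtopology (power_topology X) ?K) euclidean G"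
      unfolding G_def P_def continuous_map_atin limitin_canonical_iff
      \<comment> \<open>Continuity is restated as limits at points so that the limit rules for
        finite products and quotients apply.\<close>
      by (intro ballI tendsto_intros) (auto simp: P_def)
    then show "continuous_map (subtopology (power_topology X) ?S) euclidean (F \<circ> sym_class)"
      unfolding FG using sub by (rule continuous_map_from_subtopology_mono)
  qed

  have F_less: "cmod (F C) < 1" if C: "C \<in> sym_power_set Y" for C
  proof -
    obtain w where w: "w \<in> cart_power_set Y" "C = sym_class w"
      using C by (auto simp: sym_power_set_def)
    have "1 < cmod (1 + P w)"
      using P_pos[OF w(1)] complex_Re_le_cmod[of "1 + P w"] by simp
    then show ?thesis
      by (simp add: w(2) F_class G_def norm_divide divide_less_eq_1)
  qed

  \<comment> \<open>The single factor at \<open>k\<close> vanishes, since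
    \<open>f (z k) = 1\<close>; the values of \<open>f\<close> at the other \<open>z j\<close> do
    not matter.\<close>
  have "P z = 0"
    unfolding P_def using f_z by (intro prod_zero) (auto simp: r_def intro!: bexI[of _ k])
  then have "F (sym_class z) = 1"
    by (simp add: F_class G_def)
  then show ?thesis
    unfolding A_peak_point_def A_algebra_def
    using F_hol F_cont F_less sym_class_in_closure[of z X Y] z_closure by blast
qed

end
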